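(* Let $\mathbf{k}$ be a field of characteristic $0$. (1) Let $(R,d)$ be a differential algebra of weight $0$ with a central element $\lambda\in R$. Then $(R,dL_\lambda,d(\lambda))$ is a modified differential algebra of weight $d(\lambda)$. (2) Let $(R,d,P)$ be a unital integro-differential algebra of weight $0$ with an invertible central element $\lambda\in R$. Then $(R,dL_{\lambda^{-1}},L_\lambda P)$ is a modified integro-differential algebra, and also a differential Reynolds algebra.
   Context: Algebras are unitary associative $\mathbf{k}$-algebras (not necessarily commutative); linear means $\mathbf{k}$-linear. For $\lambda\in R$, $L_\lambda:R\to R$, $x\mapsto\lambda x$; products of operators are compositions, so $dL_\lambda(x)=d(\lambda x)$ and $L_\lambda P(x)=\lambda P(x)$. A differential algebra of weight $0$ is an algebra $R$ with a linear operator $d$ satisfying $d(xy)=d(x)y+xd(y)$. An integro-differential algebra of weight $0$ is a triple $(R,d,P)$ where $(R,d)$ is a differential algebra of weight $0$ and $P$ is a linear operator on $R$ with $dP=\mathrm{id}_R$ and $P(d(x))P(d(y))=P(d(x))y+xP(d(y))-P(d(xy))$ for all $x,y\in R$. A modified differential algebra of weight $w\in R$ is a triple $(R,D,w)$ with $D:R\to R$ linear satisfying $D(xy)=D(x)y+xD(y)-xwy$ for all $x,y\in R$. A unit-modified differential algebra is a pair $(R,D)$ which is a modified differential algebra of weight $w=D(1_R)$. A modified integro-differential algebra is a triple $(R,D,\Pi)$ where $(R,D)$ is a unit-modified differential algebra and $\Pi$ is a linear operator on $R$ with $D\Pi=\mathrm{id}_R$ and, for all $x,y\in R$, $$\Pi(D(x))\Pi(D(y))=\Pi(D(x))y+x\Pi(D(y))-\Pi(D(xy))-\Pi(D(1_R))\big(xy-\Pi(D(xy))\big).$$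 A differential Reynolds algebra is a triple $(R,D,\Pi)$ where $(R,D)$ is a unit-modified differential algebra and $\Pi$ is a linear operator on $R$ with $D\Pi=\mathrm{id}_R$ and, for all $x,y\in R$, $$\Pi(x)\Pi(y)=\Pi(\Pi(x)y)+\Pi(x\Pi(y))-\Pi(\Pi(x)D(1_R)\Pi(y)).$$ *)

theory Defs
  imports Complex_Main
begin

text \<open>
  The sort \<open>{ring, monoid_mult}\<close> is that of unitary associative, not necessarily commutative rings.
  It is \<open>ring_1\<close> without the axiom \<open>0 \<noteq> 1\<close>, so that the zero algebra is included.
\<close>

locale unital_algebra = vector_space scale
  for scale :: "'k::field \<Rightarrow> 'a::{ring, monoid_mult} \<Rightarrow> 'a" +
  assumes scale_mult_left: "scale c x * y = scale c (x * y)"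
    and scale_mult_right: "x * scale c y = scale c (x * y)"

locale differential_algebra = unital_algebra scale
  for scale :: "'k::field \<Rightarrow> 'a::{ring, monoid_mult} \<Rightarrow> 'a"
    and d :: "'a \<Rightarrow> 'a" +
  assumes d_linear: "Vector_Spaces.linear scale scale d"
    and d_mult: "d (x * y) = d x * y + x * d y"

locale integro_differential_algebra = differential_algebra scale d
  for scale :: "'k::field \<Rightarrow> 'a::{ring, monoid_mult} \<Rightarrow> 'a"
    and d P :: "'a \<Rightarrow> 'a" +
  assumes P_linear: "Vector_Spaces.linear scale scale P"
    and d_P: "d \<circ> P = id"
    and P_d: "P (d x) * P (d y) = P (d x) * y + x * P (d y) - P (d (x * y))"

locale modified_differential_algebra = unital_algebra scale
  for scale :: "'k::field \<Rightarrow> 'a::{ring, monoid_mult} \<Rightarrow> 'a"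
    and D :: "'a \<Rightarrow> 'a" and w :: 'a +
  assumes D_linear: "Vector_Spaces.linear scale scale D"
    and D_mult: "D (x * y) = D x * y + x * D y - x * w * y"

locale unit_modified_differential_algebra = modified_differential_algebra scale D "D 1"
  for scale :: "'k::field \<Rightarrow> 'a::{ring, monoid_mult} \<Rightarrow> 'a"
    and D :: "'a \<Rightarrow> 'a"

locale modified_integro_differential_algebra = unit_modified_differential_algebra scale D
  for scale :: "'k::field \<Rightarrow> 'a::{ring, monoid_mult} \<Rightarrow> 'a"
    and D \<Pi> :: "'a \<Rightarrow> 'a" +
  assumes Pi_linear: "Vector_Spaces.linear scale scale \<Pi>"
    and D_Pi: "D \<circ> \<Pi> = id"
    and Pi_D: "\<Pi> (D x) * \<Pi> (D y) =
      \<Pi> (D x) * y + x * \<Pi> (D y) - \<Pi> (D (x * y)) - \<Pi> (D 1) * (x * y - \<Pi> (D (x * y)))"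

locale differential_Reynolds_algebra = unit_modified_differential_algebra scale D
  for scale :: "'k::field \<Rightarrow> 'a::{ring, monoid_mult} \<Rightarrow> 'a"
    and D \<Pi> :: "'a \<Rightarrow> 'a" +
  assumes Pi_linear: "Vector_Spaces.linear scale scale \<Pi>"
    and D_Pi: "D \<circ> \<Pi> = id"
    and Reynolds: "\<Pi> x * \<Pi> y = \<Pi> (\<Pi> x * y) + \<Pi> (x * \<Pi> y) - \<Pi> (\<Pi> x * D 1 * \<Pi> y)"

definition left_mult :: "'a::times \<Rightarrow> 'a \<Rightarrow> 'a" where
  "left_mult a = (\<lambda>x. a * x)"

definition central :: "'a::times \<Rightarrow> bool" where
  "central a \<longleftrightarrow> (\<forall>x. a * x = x * a)"

definition invertible_element :: "'a::monoid_mult \<Rightarrow> bool" where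
  "invertible_element a \<longleftrightarrow> (\<exists>b. a * b = 1 \<and> b * a = 1)"

text \<open>Two-sided inverses are unique; the value is only meaningful for invertible elements.\<close>

definition inverse_element :: "'a::monoid_mult \<Rightarrow> 'a" where
  "inverse_element a = (THE b. a * b = 1 \<and> b * a = 1)"

end

theory Submission
  imports Defs
begin

text \<open>
  Put \<open>J = P \<circ> d\<close> and \<open>\<mu> = \<lambda>\<inverse>\<close>. The integro-differential identity is
  \<open>J x * J y = J x * y + x * J y - J (x * y)\<close>, and \<open>J\<close> fixes the image of \<open>P\<close>; hence it also fixes
  products \<open>P x * P y\<close> (the Rota--Baxter identity) and their multiples by \<open>\<lambda>\<close>. The modified
  identity is \<open>\<lambda>\<^sup>2\<close> times this identity at \<open>(\<mu> x, \<mu> y)\<close>, with the remaining term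
  \<open>J (\<mu>\<^sup>2 x y)\<close> eliminated by the identity at \<open>(\<mu>, \<mu> x y)\<close>. The Reynolds identity
  says that \<open>J\<close> fixes \<open>\<lambda> * P x * P y\<close>, because \<open>\<lambda>\<^sup>2 * d \<mu> = - d \<lambda>\<close>.
\<close>

lemma central_commute: "central l \<Longrightarrow> x * l = l * x"
  by (simp add: central_def)

lemma central_left_commute: "central l \<Longrightarrow> x * (l * y) = l * (x * (y::'a::semigroup_mult))"
  by (metis central_def mult.assoc)

lemma inverse_element:
  fixes l :: "'a::monoid_mult"
  assumes "invertible_element l"
  shows "l * inverse_element l = 1" "inverse_element l * l = 1"
proof -
  obtain b where b: "l * b = 1 \<and> b * l = 1"
    using assms by (auto simp: invertible_element_def)
  moreover have "c = b" if "l * c = 1 \<and> c * l = 1" for c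
    using that b by (metis mult.assoc mult_1_left mult_1_right)
  ultimately have "l * inverse_element l = 1 \<and> inverse_element l * l = 1"
    unfolding inverse_element_def by (rule theI)
  then show "l * inverse_element l = 1" "inverse_element l * l = 1" by auto
qed

lemma central_inverse_element:
  fixes l :: "'a::monoid_mult"
  assumes "central l" "invertible_element l"
  shows "central (inverse_element l)"
  unfolding central_def
proof
  fix x
  let ?m = "inverse_element l"
  have "?m * x = ?m * (x * (l * ?m))"
    using assms by (simp add: inverse_element)
  also have "\<dots> = (?m * l) * (x * ?m)"
    using assms by (simp add: central_left_commute mult.assoc)
  finally show "?m * x = x * ?m"
    using assms by (simp add: inverse_element)
qed

lemma (in unital_algebra) linear_left_mult: "Vector_Spaces.linear scale scale (left_mult a)"
  by unfold_locales (simp_all add: left_mult_def distrib_left scale_mult_right)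

context differential_algebra
begin

lemma d_one: "d 1 = 0"
  using d_mult[of 1 1] by simp

text \<open>Differentiate \<open>l * x = x * l\<close>: the terms with \<open>d x\<close> cancel
  because \<open>l\<close> commutes with \<open>d x\<close>.\<close>

lemma d_central_commute:
  assumes "central l"
  shows "x * d l = d l * x"
proof -
  have "d l * x + l * d x = d x * l + x * d l"
    using assms by (metis central_def d_mult)
  then show ?thesis
    using assms by (simp add: central_commute add.commute)
qed

text \<open>Both \<open>d (l * x) * y\<close> and \<open>x * d (l * y)\<close> differentiate the
  factor \<open>l\<close>, but \<open>d (l * (x * y))\<close> does so only once. The weight term
  removes the surplus \<open>x * d l * y\<close>.\<close>

lemma modified_differential_algebra_left_mult:
  assumes "central l"
  shows "modified_differential_algebra scale (d \<circ> left_mult l) (d l)"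
proof (rule modified_differential_algebra.intro[OF unital_algebra_axioms],
    rule modified_differential_algebra_axioms.intro)
  show "Vector_Spaces.linear scale scale (d \<circ> left_mult l)"
    using linear_left_mult d_linear by (rule Vector_Spaces.linear_compose)
  show "(d \<circ> left_mult l) (x * y) =
      (d \<circ> left_mult l) x * y + x * (d \<circ> left_mult l) y - x * d l * y" for x y
    using assms by (simp add: left_mult_def d_mult central_left_commute algebra_simps)
qed

lemma unit_modified_differential_algebra_left_mult:
  assumes "central l"
  shows "unit_modified_differential_algebra scale (d \<circ> left_mult l)"
  using modified_differential_algebra_left_mult[OF assms]
  by (simp add: unit_modified_differential_algebra_def left_mult_def)

end

context integro_differential_algebra
begin

lemma d_P_apply: "d (P x) = x"
  using d_P by (metis comp_apply id_apply)

lemma P_mult_P: "P x * P y = P (d (P x * P y))"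
  using P_d[of "P x" "P y"] by (simp add: d_P_apply)

text \<open>In the identity at \<open>l\<close> and \<open>z\<close> the products
  \<open>P (d l) * z\<close> cancel. So the fixed points of \<open>J\<close> form a left
  ideal.\<close>

lemma P_d_mult_left:
  assumes "P (d z) = z"
  shows "P (d (l * z)) = l * z"
  using P_d[of l z] by (simp add: assms)

context
  fixes l m :: 'a
  assumes l: "central l" and m: "central m"
    and lm: "l * m = 1"
begin

lemma l_m_cancel: "l * (m * x) = x" "m * (l * x) = x"
  using lm central_commute[OF l, of m] by (metis mult.assoc mult_1_left)+

lemma D_Pi_conjugate: "(d \<circ> left_mult m) \<circ> (left_mult l \<circ> P) = id"
  by (simp add: fun_eq_iff left_mult_def l_m_cancel d_P_apply)

lemma linear_left_mult_P: "Vector_Spaces.linear scale scale (left_mult l \<circ> P)"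
  using P_linear linear_left_mult by (rule Vector_Spaces.linear_compose)

text \<open>Each mixed term has one \<open>m\<close> outside \<open>J\<close>, which cancels one of
  the two factors \<open>l\<close>. In the last term both factors \<open>m\<close> stay inside
  \<open>J\<close>, so \<open>l * l\<close> survives there.\<close>

lemma l_l_P_d:
  "l * (l * (P (d (m * x)) * P (d (m * y)))) =
    l * P (d (m * x)) * y + x * (l * P (d (m * y))) - l * (l * P (d (m * (m * (x * y)))))"
proof -
  have "P (d (m * x)) * P (d (m * y)) =
      m * (P (d (m * x)) * y) + m * (x * P (d (m * y))) - P (d (m * (m * (x * y))))"
    using P_d[of "m * x" "m * y"] by (simp add: mult.assoc central_left_commute[OF m, of x]
          central_left_commute[OF m, of "P (d (m * x))"])
  then show ?thesis
    by (simp add: right_diff_distrib distrib_left l_m_cancel mult.assoc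
        central_left_commute[OF l, of x])
qed

lemma modified_integro_differential_algebra_conjugate:
  "modified_integro_differential_algebra scale (d \<circ> left_mult m) (left_mult l \<circ> P)"
proof -
  show ?thesis
  proof (rule modified_integro_differential_algebra.intro,
      rule unit_modified_differential_algebra_left_mult[OF m],
      rule modified_integro_differential_algebra_axioms.intro,
      rule linear_left_mult_P, rule D_Pi_conjugate)
    fix x y
    let ?J = "\<lambda>x. P (d x)"
    have *: "(l * u) * (l * v) = l * (l * (u * v))" for u v
      by (simp add: mult.assoc central_left_commute[OF l, of u])
    \<comment> \<open>The pairs \<open>(1, x * y)\<close> and \<open>(x, y)\<close> have the same
      product, so their instances of \<open>l_l_P_d\<close> share the last term, and subtraction
      removes it.\<close>
    have "l * (l * (?J m * ?J (m * (x * y)))) =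
        l * ?J m * (x * y) + l * ?J (m * (x * y)) - l * (l * ?J (m * (m * (x * y))))"
      using l_l_P_d[of 1 "x * y"] by simp
    then have "(l * ?J (m * x)) * (l * ?J (m * y)) =
        l * ?J (m * x) * y + x * (l * ?J (m * y)) - l * ?J (m * (x * y))
          - (l * ?J m * (x * y) - (l * ?J m) * (l * ?J (m * (x * y))))"
      unfolding * l_l_P_d[of x y] by (simp add: algebra_simps)
    then show "(left_mult l \<circ> P) ((d \<circ> left_mult m) x) * (left_mult l \<circ> P) ((d \<circ> left_mult m) y) =
        (left_mult l \<circ> P) ((d \<circ> left_mult m) x) * y + x * (left_mult l \<circ> P) ((d \<circ> left_mult m) y)
        - (left_mult l \<circ> P) ((d \<circ> left_mult m) (x * y))
        - (left_mult l \<circ> P) ((d \<circ> left_mult m) 1) *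
          (x * y - (left_mult l \<circ> P) ((d \<circ> left_mult m) (x * y)))"
      by (simp add: left_mult_def right_diff_distrib)
  qed
qed

text \<open>The rule for the derivative of an inverse, from differentiating
  \<open>l * m = 1\<close>.\<close>

lemma l_l_d_m: "l * (l * d m) = - d l"
proof -
  have "d l * m + l * d m = 0"
    using d_mult[of l m] by (simp add: lm d_one)
  then have "l * d m = - (m * d l)"
    using m by (simp add: central_commute eq_neg_iff_add_eq_0 add.commute)
  then show ?thesis
    by (simp add: l_m_cancel)
qed

lemma differential_Reynolds_algebra_conjugate:
  "differential_Reynolds_algebra scale (d \<circ> left_mult m) (left_mult l \<circ> P)"
proof -
  interpret P: Vector_Spaces.linear scale scale P
    by (rule P_linear)
  show ?thesis
  proof (rule differential_Reynolds_algebra.intro,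
      rule unit_modified_differential_algebra_left_mult[OF m],
      rule differential_Reynolds_algebra_axioms.intro,
      rule linear_left_mult_P, rule D_Pi_conjugate)
    fix x y
    \<comment> \<open>The weight is \<open>d (m * 1) = d m\<close>. It commutes with
      \<open>P x\<close> because \<open>m\<close> is central.\<close>
    have "l * P x * d m * (l * P y) = l * (l * d m) * (P x * P y)"
      by (simp add: mult.assoc central_left_commute[OF l, of "P x"]
          central_left_commute[OF l, of "d m"])
        (metis d_central_commute[OF m] mult.assoc)
    then have "l * P x * d m * (l * P y) = - (d l * (P x * P y))"
      by (simp add: l_l_d_m)
    \<comment> \<open>By the product rule, the arguments of \<open>P\<close> in the Reynolds
      identity add up to an exact derivative; the weight term supplies the summand
      \<open>d l * (P x * P y)\<close>.\<close>
    then have "d (l * (P x * P y)) = l * P x * y + x * (l * P y) - l * P x * d m * (l * P y)"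
      by (simp add: d_mult d_P_apply central_left_commute[OF l, of x] algebra_simps)
    then have "P (l * P x * y) + P (x * (l * P y)) - P (l * P x * d m * (l * P y)) =
        l * (P x * P y)"
      using P_d_mult_left[OF P_mult_P[symmetric]] by (metis P.add P.diff)
    then have "l * P x * (l * P y) =
        l * P (l * P x * y) + l * P (x * (l * P y)) - l * P (l * P x * d m * (l * P y))"
      by (simp add: central_left_commute[OF l, of "P x"] mult.assoc
          flip: distrib_left right_diff_distrib)
    then show "(left_mult l \<circ> P) x * (left_mult l \<circ> P) y =
        (left_mult l \<circ> P) ((left_mult l \<circ> P) x * y) + (left_mult l \<circ> P) (x * (left_mult l \<circ> P) y)
        - (left_mult l \<circ> P) ((left_mult l \<circ> P) x * (d \<circ> left_mult m) 1 * (left_mult l \<circ> P) y)"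
      by (simp add: left_mult_def)
  qed
qed

end

end

theorem theorem2p5:
  fixes scale :: "'k::field_char_0 \<Rightarrow> 'a::{ring, monoid_mult} \<Rightarrow> 'a"
  shows
    "(\<forall>d l. differential_algebra scale d \<and> central l \<longrightarrow>
        modified_differential_algebra scale (d \<circ> left_mult l) (d l)) \<and>
     (\<forall>d P l. integro_differential_algebra scale d P \<and> central l \<and> invertible_element l \<longrightarrow>
        modified_integro_differential_algebra scale
          (d \<circ> left_mult (inverse_element l)) (left_mult l \<circ> P) \<and>
        differential_Reynolds_algebra scale
          (d \<circ> left_mult (inverse_element l)) (left_mult l \<circ> P))"
  \<comment> \<open>The arbitrary central \<open>m\<close> with \<open>l * m = 1\<close> is now
    taken to be \<open>inverse_element l\<close>.\<close>
  by (auto intro!: differential_algebra.modified_differential_algebra_left_mult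
      integro_differential_algebra.modified_integro_differential_algebra_conjugate
      integro_differential_algebra.differential_Reynolds_algebra_conjugate
      central_inverse_element inverse_element(1))

end
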